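(* Let $e\ge 0$, $r\ge 1$ and $n\ge 0$ be integers. The $(e,r)$-partitions with $n+1$ parts are precisely the positive integer points $(\lambda_0,\lambda_1,\ldots,\lambda_n)$ that satisfy $\lambda_0\le\lambda_1\le\cdots\le\lambda_n$ and $$\lambda_i \le (e+1)+r\sum_{j=0}^{i-1}\lambda_j\qquad\text{for each } i=0,1,\ldots,n$$ (for $i=0$ the sum is empty, so the condition reads $\lambda_0\le e+1$). Furthermore, among these $(e,r)$-partitions with $n+1$ parts, the minimal ones are precisely those whose sum $|\lambda|:=\lambda_0+\lambda_1+\cdots+\lambda_n$ lies in the interval $$\left[(e+1)\frac{(r+1)^{n}-1}{r}+1,\ (e+1)\frac{(r+1)^{n+1}-1}{r}\right].$$
   Context: A partition of a positive integer $m$ with $n+1$ parts is an expression $m=\lambda_0+\lambda_1+\cdots+\lambda_n$ with positive integer parts in (weakly) increasing order $\lambda_0\le\lambda_1\le\cdots\le\lambda_n$. For integers $e\ge 0$ and $r\ge1$, such a partition is called an $e$-relaxed $r$-complete partition, or $(e,r)$-partition for short, if no $e+1$ consecutive integers between $0$ and $rm$ are all absent from the set $\{\sum_{i=0}^n\alpha_i\lambda_i : \alpha_i\in\{0,1,\ldots,r\}\}$. An $(e,r)$-partition of $m$ is minimal if its number of parts is the smallest possible among all $(e,r)$-partitions of $m$. *)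

theory Defs
  imports Complex_Main
begin

definition partition_of :: "nat \<Rightarrow> nat list \<Rightarrow> bool" where
  "partition_of m xs \<longleftrightarrow>
     m > 0 \<and> sorted xs \<and> (\<forall>x\<in>set xs. x > 0) \<and> sum_list xs = m"

definition weighted_sums :: "nat \<Rightarrow> nat list \<Rightarrow> nat set" where
  "weighted_sums r xs =
     {(\<Sum>i<length xs. \<alpha> i * xs ! i) | \<alpha>. \<forall>i<length xs. \<alpha> i \<in> {0..r}}"

text \<open>
  A block of \<open>e + 1\<close> consecutive integers is \<open>{k..k + e}\<close>; only blocks contained in
  \<open>{0..r * m}\<close> count.
\<close>

definition relaxed_complete_partition :: "nat \<Rightarrow> nat \<Rightarrow> nat \<Rightarrow> nat list \<Rightarrow> bool" where
  "relaxed_complete_partition e r m xs \<longleftrightarrow>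
     partition_of m xs \<and>
     \<not> (\<exists>k. {k..k + e} \<subseteq> {0..r * m} \<and> {k..k + e} \<inter> weighted_sums r xs = {})"

definition minimal_relaxed_complete_partition :: "nat \<Rightarrow> nat \<Rightarrow> nat \<Rightarrow> nat list \<Rightarrow> bool" where
  "minimal_relaxed_complete_partition e r m xs \<longleftrightarrow>
     relaxed_complete_partition e r m xs \<and>
     (\<forall>ys. relaxed_complete_partition e r m ys \<longrightarrow> length xs \<le> length ys)"

end

(* A partition with no e + 1 consecutive gaps cannot have a part exceeding (e + 1) + r * (sum of the
   smaller parts), since otherwise the block right after r times that sum is missed; conversely, adding
   a part that respects the bound never opens a gap of length e + 1.  The bounds make the k-part
   partitions have sum at most B(k) = (e + 1) * (1 + (r + 1) + ... + (r + 1)^(k - 1)).  Every positive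
   m up to B(k) is attained with at most k parts by the greedy choice of the remainder
   m' = ceiling ((m - e - 1) / (r + 1)) and largest part m - m'; as m' is at most m / 2, the largest
   part is at least m' and the parts are automatically sorted. *)

theory Submission
  imports Defs
begin

section \<open>Bounds on the parts and the extremal sum\<close>

definition parts_bounded :: "nat \<Rightarrow> nat \<Rightarrow> nat list \<Rightarrow> bool" where
  "parts_bounded e r xs \<longleftrightarrow> (\<forall>i<length xs. xs ! i \<le> (e + 1) + r * (\<Sum>j<i. xs ! j))"

text \<open>The geometric sum behind \<open>(e + 1) * ((r + 1) ^ k - 1) / r\<close>, kept free of
  division so that the arguments stay in \<open>nat\<close>.\<close>

definition max_sum :: "nat \<Rightarrow> nat \<Rightarrow> nat \<Rightarrow> nat" where
  "max_sum e r k = (e + 1) * (\<Sum>i<k. (r + 1) ^ i)"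

lemma sum_nth_append_left:
  "i \<le> length xs \<Longrightarrow> (\<Sum>j<i. (xs @ ys) ! j) = (\<Sum>j<i. xs ! j)"
  by (intro sum.cong) (auto simp: nth_append)

lemma parts_bounded_Nil [simp]: "parts_bounded e r []"
  by (simp add: parts_bounded_def)

lemma parts_bounded_snoc [simp]:
  "parts_bounded e r (xs @ [x]) \<longleftrightarrow> parts_bounded e r xs \<and> x \<le> (e + 1) + r * sum_list xs"
proof -
  have "(\<forall>i<length xs. (xs @ [x]) ! i \<le> (e + 1) + r * (\<Sum>j<i. (xs @ [x]) ! j)) \<longleftrightarrow>
        parts_bounded e r xs"
    unfolding parts_bounded_def by (simp add: sum_nth_append_left nth_append)
  moreover have "(\<Sum>j<length xs. (xs @ [x]) ! j) = sum_list xs"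
    by (simp add: sum_nth_append_left sum_list_sum_nth atLeast0LessThan)
  ultimately show ?thesis
    by (auto simp: parts_bounded_def less_Suc_eq)
qed

section \<open>Weighted sums and their gaps\<close>

lemma weighted_sums_Nil [simp]: "weighted_sums r [] = {0}"
  by (auto simp: weighted_sums_def)

lemma weighted_sums_snoc:
  "weighted_sums r (xs @ [x]) = {a + c * x | a c. a \<in> weighted_sums r xs \<and> c \<le> r}"
proof (intro equalityI subsetI)
  fix w assume "w \<in> weighted_sums r (xs @ [x])"
  then obtain \<alpha> where \<alpha>: "\<forall>i<Suc (length xs). \<alpha> i \<le> r"
    and w: "w = (\<Sum>i<Suc (length xs). \<alpha> i * (xs @ [x]) ! i)"
    by (auto simp: weighted_sums_def)
  have "w = (\<Sum>i<length xs. \<alpha> i * xs ! i) + \<alpha> (length xs) * x"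
    by (simp add: w nth_append)
  moreover have "(\<Sum>i<length xs. \<alpha> i * xs ! i) \<in> weighted_sums r xs"
    using \<alpha> by (auto simp: weighted_sums_def)
  ultimately show "w \<in> {a + c * x | a c. a \<in> weighted_sums r xs \<and> c \<le> r}"
    using \<alpha> by blast
next
  fix w assume "w \<in> {a + c * x | a c. a \<in> weighted_sums r xs \<and> c \<le> r}"
  then obtain \<alpha> c where \<alpha>: "\<forall>i<length xs. \<alpha> i \<le> r" "c \<le> r"
    and w: "w = (\<Sum>i<length xs. \<alpha> i * xs ! i) + c * x"
    by (auto simp: weighted_sums_def)
  let ?\<beta> = "\<alpha>(length xs := c)"
  have "w = (\<Sum>i<length (xs @ [x]). ?\<beta> i * (xs @ [x]) ! i)"
    by (simp add: w nth_append)
  moreover have "\<forall>i<length (xs @ [x]). ?\<beta> i \<in> {0..r}"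
    using \<alpha> by (auto simp: less_Suc_eq)
  ultimately show "w \<in> weighted_sums r (xs @ [x])"
    unfolding weighted_sums_def by blast
qed

lemma zero_in_weighted_sums: "0 \<in> weighted_sums r xs"
proof -
  have "(\<Sum>i<length xs. 0 * xs ! i) \<in> weighted_sums r xs"
    unfolding weighted_sums_def by force
  then show ?thesis
    by simp
qed

text \<open>Sums using c copies of the last part x are a translate by \<open>c * x\<close> of the
  sums of \<open>xs\<close>. By induction each translate meets every window starting in its range,
  and the bound on x lets the windows between two translates catch the start of the next.\<close>

lemma parts_bounded_imp_no_gap:
  assumes "parts_bounded e r xs" "k \<le> r * sum_list xs"
  shows "\<exists>w\<in>weighted_sums r xs. k \<le> w \<and> w \<le> k + e"
  using assms
proof (induction xs arbitrary: k rule: rev_induct)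
  case Nil
  then show ?case by simp
next
  case (snoc x xs)
  let ?S = "r * sum_list xs"
  have x: "x \<le> e + 1 + ?S" and IH: "\<And>k. k \<le> ?S \<Longrightarrow> \<exists>w\<in>weighted_sums r xs. k \<le> w \<and> w \<le> k + e"
    using snoc by auto
  have k: "k \<le> ?S + r * x"
    using snoc.prems by (simp add: algebra_simps)
  have reach: ?case if c: "c \<le> r" "c * x \<le> k" "k - c * x \<le> ?S" for c
  proof -
    obtain w where "w \<in> weighted_sums r xs" "k - c * x \<le> w" "w \<le> k - c * x + e"
      using IH[OF c(3)] by blast
    then show ?thesis
      using c by (intro bexI[of _ "w + c * x"]) (auto simp: weighted_sums_snoc)
  qed
  show ?case
  proof (cases "r * x \<le> k")
    case True
    then show ?thesis
      using reach[of r] k by simp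
  next
    case False
    then have "0 < x"
      by (cases x) auto
    \<comment> \<open>The largest number of copies of x not exceeding k; it stays below r because
      here \<open>k < r * x\<close>, so one more copy is still allowed.\<close>
    define c where "c = k div x"
    have cx: "c * x \<le> k" "k < c * x + x"
      using \<open>0 < x\<close> dividend_less_div_times[of x k] by (auto simp: c_def)
    then have c: "c < r"
      using False by (metis le_less_trans linorder_not_le mult_less_cancel2)
    show ?thesis
    proof (cases "k - c * x \<le> ?S")
      case True
      then show ?thesis
        using reach[of c] c cx by simp
    next
      case False
      \<comment> \<open>Here k exceeds \<open>c * x + ?S\<close> by at least 1, which is why a part
        as large as \<open>e + 1 + ?S\<close> still puts \<open>Suc c * x\<close> at most e beyond
        k.\<close>
      have "0 + Suc c * x \<in> weighted_sums r (xs @ [x])"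
        using c zero_in_weighted_sums[of r xs] Suc_leI unfolding weighted_sums_snoc by blast
      moreover have "k \<le> 0 + Suc c * x" "0 + Suc c * x \<le> k + e"
        using cx x False by auto
      ultimately show ?thesis
        by blast
    qed
  qed
qed

text \<open>A nonzero coefficient at some index from i on contributes at least \<open>xs ! i\<close>
  by sortedness; otherwise only the first i parts contribute, each at most r times.\<close>

lemma weighted_sum_below_or_above:
  assumes "sorted xs" "i < length xs" "w \<in> weighted_sums r xs"
  shows "w \<le> r * (\<Sum>j<i. xs ! j) \<or> xs ! i \<le> w"
proof -
  obtain \<alpha> where \<alpha>: "\<forall>j<length xs. \<alpha> j \<le> r" and w: "w = (\<Sum>j<length xs. \<alpha> j * xs ! j)"
    using assms by (auto simp: weighted_sums_def)
  show ?thesis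
  proof (cases "\<exists>j<length xs. i \<le> j \<and> \<alpha> j \<noteq> 0")
    case True
    then obtain j where j: "j < length xs" "i \<le> j" "\<alpha> j \<noteq> 0"
      by blast
    have "xs ! i \<le> xs ! j"
      using assms j by (simp add: sorted_nth_mono)
    also have "\<dots> \<le> \<alpha> j * xs ! j"
      using j by simp
    also have "\<dots> \<le> w"
      unfolding w using j by (intro member_le_sum) auto
    finally show ?thesis ..
  next
    case False
    then have "w = (\<Sum>j<i. \<alpha> j * xs ! j)"
      unfolding w using assms(2) by (intro sum.mono_neutral_right) auto
    also have "\<dots> \<le> (\<Sum>j<i. r * xs ! j)"
      using \<alpha> assms(2) by (intro sum_mono mult_right_mono) auto
    finally show ?thesis
      by (simp add: sum_distrib_left)
  qed
qed

lemma relaxed_complete_imp_parts_bounded: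
  assumes "r \<ge> 1" "relaxed_complete_partition e r m xs"
  shows "parts_bounded e r xs"
proof (rule ccontr)
  have sorted: "sorted xs" and m: "m = sum_list xs"
    and meets: "\<And>k. {k..k + e} \<subseteq> {0..r * m} \<Longrightarrow> {k..k + e} \<inter> weighted_sums r xs \<noteq> {}"
    using assms(2) by (auto simp: relaxed_complete_partition_def partition_of_def)
  assume "\<not> parts_bounded e r xs"
  then obtain i where i: "i < length xs" and gap: "e + 1 + r * (\<Sum>j<i. xs ! j) < xs ! i"
    by (auto simp: parts_bounded_def not_le)
  let ?k = "Suc (r * (\<Sum>j<i. xs ! j))"
  \<comment> \<open>Only blocks inside \<open>{0..r * m}\<close> count. This one ends before
    \<open>xs ! i\<close>, which is at most \<open>r * m\<close> because r is at least 1.\<close>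
  have "xs ! i \<le> m"
    using i by (simp add: m elem_le_sum_list)
  also have "\<dots> \<le> r * m"
    using assms(1) by simp
  finally have "{?k..?k + e} \<subseteq> {0..r * m}"
    using gap by auto
  then obtain w where "w \<in> weighted_sums r xs" "?k \<le> w" "w \<le> ?k + e"
    using meets by fastforce
  then show False
    using weighted_sum_below_or_above[OF sorted i, of w r] gap by auto
qed

lemma relaxed_complete_partition_iff:
  assumes "r \<ge> 1"
  shows "relaxed_complete_partition e r m xs \<longleftrightarrow> partition_of m xs \<and> parts_bounded e r xs"
proof (intro iffI conjI)
  assume "partition_of m xs \<and> parts_bounded e r xs"
  then have part: "partition_of m xs" and bdd: "parts_bounded e r xs" and m: "m = sum_list xs"
    by (auto simp: partition_of_def)
  have "{k..k + e} \<inter> weighted_sums r xs \<noteq> {}" if "{k..k + e} \<subseteq> {0..r * m}" for k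
  proof -
    have "k \<le> r * sum_list xs"
      using that m by auto
    then show ?thesis
      using parts_bounded_imp_no_gap[OF bdd] by fastforce
  qed
  then show "relaxed_complete_partition e r m xs"
    using part by (auto simp: relaxed_complete_partition_def)
qed (use assms in \<open>auto simp: relaxed_complete_partition_def
       intro: relaxed_complete_imp_parts_bounded[unfolded relaxed_complete_partition_def]\<close>)

section \<open>Sums attainable with a given number of parts\<close>

lemma max_sum_0 [simp]: "max_sum e r 0 = 0"
  by (simp add: max_sum_def)

lemma max_sum_Suc: "max_sum e r (Suc k) = (e + 1) + (r + 1) * max_sum e r k"
  unfolding max_sum_def by (subst sum.lessThan_Suc_shift) (simp add: sum_distrib_left algebra_simps)

lemma max_sum_mono: "k \<le> l \<Longrightarrow> max_sum e r k \<le> max_sum e r l"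
  unfolding max_sum_def by (intro mult_left_mono sum_mono2) auto

lemma real_max_sum:
  assumes "r \<ge> 1"
  shows "real (max_sum e r k) = (real e + 1) * (((real r + 1) ^ k - 1) / real r)"
  using assms geometric_sum[of "real r + 1" k]
  unfolding max_sum_def of_nat_mult of_nat_sum of_nat_power of_nat_add of_nat_1 by simp

text \<open>Appending a part turns a sum S into at most \<open>(e + 1) + (r + 1) * S\<close>, the
  recursion of \<open>max_sum\<close>.\<close>

lemma parts_bounded_sum_le:
  "parts_bounded e r xs \<Longrightarrow> sum_list xs \<le> max_sum e r (length xs)"
proof (induction xs rule: rev_induct)
  case (snoc x xs)
  then have "sum_list (xs @ [x]) \<le> (e + 1) + (r + 1) * sum_list xs"
    by simp
  also have "\<dots> \<le> (e + 1) + (r + 1) * max_sum e r (length xs)"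
    using snoc by (intro add_left_mono mult_left_mono) auto
  finally show ?case
    by (simp add: max_sum_Suc)
qed simp

lemma ex_short_partition:
  assumes "r \<ge> 1" "0 < m" "m \<le> max_sum e r k"
  shows "\<exists>xs. partition_of m xs \<and> parts_bounded e r xs \<and> length xs \<le> k"
  using assms(2,3)
proof (induction k arbitrary: m)
  case 0
  then show ?case by simp
next
  case (Suc k)
  show ?case
  proof (cases "m \<le> e + 1")
    case True
    then have "partition_of m [m]" "parts_bounded e r ([] @ [m])"
      using Suc.prems by (simp_all only: partition_of_def parts_bounded_snoc) auto
    then show ?thesis
      by (intro exI[of _ "[m]"]) simp
  next
    case False
    \<comment> \<open>Adding r before dividing rounds up: m' is the least remainder for which the
      last part \<open>m - m'\<close> respects its bound, as \<open>lower\<close> records.\<close>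
    define m' where "m' = (m - (e + 1) + r) div (r + 1)"
    have upper: "(r + 1) * m' \<le> m - (e + 1) + r"
      unfolding m'_def by (rule times_div_less_eq_dividend)
    have lower: "m - (e + 1) + r < (r + 1) * m' + (r + 1)"
      unfolding m'_def using dividend_less_times_div[of "r + 1" "m - (e + 1) + r"] by simp
    have "0 < m'"
      using False by (cases "m' = 0") (use lower in auto)
    \<comment> \<open>Rounding up costs at most r, less than one multiple of \<open>r + 1\<close>,
      so the factor cancels to the bound needed for the induction hypothesis.\<close>
    have "(r + 1) * m' < (r + 1) * Suc (max_sum e r k)"
      using upper Suc.prems(2) by (simp add: max_sum_Suc)
    then have "m' \<le> max_sum e r k"
      by (simp only: mult_less_cancel1) simp
    then obtain xs where xs: "partition_of m' xs" "parts_bounded e r xs" "length xs \<le> k"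
      using Suc.IH \<open>0 < m'\<close> by blast
    \<comment> \<open>With r = q + 1 the product \<open>q * m'\<close> can be treated as an atom,
      leaving linear arithmetic.\<close>
    obtain q where q: "r = Suc q"
      using assms(1) by (cases r) auto
    have "q \<le> q * m'"
      using \<open>0 < m'\<close> by simp
    moreover have "m' + m' + q * m' \<le> m - (e + 1) + Suc q"
      using upper by (simp add: q)
    ultimately have half: "m' + m' \<le> m"
      using False by linarith
    have sum: "sum_list xs = m'"
      using xs by (simp add: partition_of_def)
    have "\<forall>y\<in>set xs. y \<le> m - m'"
      using half sum member_le_sum_list[of _ xs] by fastforce
    then have "partition_of m (xs @ [m - m'])"
      using xs half \<open>0 < m'\<close> by (auto simp: partition_of_def sorted_append)
    moreover have "parts_bounded e r (xs @ [m - m'])"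
      using xs lower by (simp add: sum)
    ultimately show ?thesis
      using xs(3) by (intro exI[of _ "xs @ [m - m']"]) auto
  qed
qed

text \<open>At most n parts suffice for a positive m exactly when
  \<open>m \<le> max_sum e r n\<close>: the greedy construction gives one direction, the bound on
  the sum together with monotonicity in the number of parts the other.\<close>

lemma minimal_relaxed_complete_partition_iff:
  assumes "r \<ge> 1" "length xs = Suc n"
  shows "minimal_relaxed_complete_partition e r m xs \<longleftrightarrow>
    relaxed_complete_partition e r m xs \<and> max_sum e r n < m"
proof -
  have "(\<forall>ys. relaxed_complete_partition e r m ys \<longrightarrow> Suc n \<le> length ys) \<longleftrightarrow> max_sum e r n < m"
    if "0 < m"
  proof
    assume "\<forall>ys. relaxed_complete_partition e r m ys \<longrightarrow> Suc n \<le> length ys"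
    then show "max_sum e r n < m"
      using ex_short_partition[OF assms(1) that, of e n] not_less_eq_eq
      unfolding relaxed_complete_partition_iff[OF assms(1)] by (meson leI)
  next
    assume less: "max_sum e r n < m"
    have False if "partition_of m ys" "parts_bounded e r ys" "length ys \<le> n" for ys
      using parts_bounded_sum_le[OF that(2)] max_sum_mono[OF that(3), of e r] that(1) less
      by (simp add: partition_of_def)
    then show "\<forall>ys. relaxed_complete_partition e r m ys \<longrightarrow> Suc n \<le> length ys"
      unfolding relaxed_complete_partition_iff[OF assms(1)] by (meson not_less_eq_eq)
  qed
  then show ?thesis
    using assms(2)
    by (auto simp: minimal_relaxed_complete_partition_def relaxed_complete_partition_def
          partition_of_def)
qed

theorem theorem2p1:
  fixes e r n :: nat
  assumes "r \<ge> 1"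
  shows "({xs. length xs = n + 1 \<and> (\<exists>m. relaxed_complete_partition e r m xs)} =
          {xs. length xs = n + 1 \<and> (\<forall>x\<in>set xs. x > 0) \<and> sorted xs \<and>
              (\<forall>i\<in>{0..n}. xs ! i \<le> (e + 1) + r * (\<Sum>j<i. xs ! j))}) \<and>
         ({xs. length xs = n + 1 \<and> (\<exists>m. minimal_relaxed_complete_partition e r m xs)} =
          {xs. length xs = n + 1 \<and> (\<exists>m. relaxed_complete_partition e r m xs) \<and>
              real (sum_list xs) \<in>
                {(real e + 1) * (((real r + 1) ^ n - 1) / real r) + 1 ..
                 (real e + 1) * (((real r + 1) ^ (n + 1) - 1) / real r)}})"
proof (intro conjI Collect_cong conj_cong refl)
  fix xs :: "nat list" assume len: "length xs = n + 1"
  \<comment> \<open>A list of n + 1 positive entries is nonempty, so its sum is a legitimate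
    m.\<close>
  have "0 < sum_list xs" if "\<forall>x\<in>set xs. 0 < x"
    using that len by (cases xs) auto
  moreover have "parts_bounded e r xs \<longleftrightarrow>
      (\<forall>i\<in>{0..n}. xs ! i \<le> (e + 1) + r * (\<Sum>j<i. xs ! j))"
    using len by (auto simp: parts_bounded_def less_Suc_eq_le)
  ultimately show "(\<exists>m. relaxed_complete_partition e r m xs) \<longleftrightarrow>
      (\<forall>x\<in>set xs. x > 0) \<and> sorted xs \<and>
      (\<forall>i\<in>{0..n}. xs ! i \<le> (e + 1) + r * (\<Sum>j<i. xs ! j))"
    by (auto simp: relaxed_complete_partition_iff[OF assms] partition_of_def)
next
  fix xs :: "nat list" assume len: "length xs = n + 1"
  \<comment> \<open>The upper end of the interval holds for every such partition; only the lower end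
    expresses minimality.\<close>
  have sum: "m = sum_list xs \<and> m \<le> max_sum e r (n + 1)"
    if "relaxed_complete_partition e r m xs" for m
    using that parts_bounded_sum_le[of e r xs] len
    by (auto simp: relaxed_complete_partition_iff[OF assms] partition_of_def)
  \<comment> \<open>Between integers, the \<open>+ 1\<close> at the lower end is the strict
    inequality of the minimality criterion.\<close>
  have "real (sum_list xs) \<in> {real (max_sum e r n) + 1 .. real (max_sum e r (n + 1))} \<longleftrightarrow>
      max_sum e r n < sum_list xs \<and> sum_list xs \<le> max_sum e r (n + 1)"
    by (auto simp del: of_nat_Suc simp flip: of_nat_Suc)
  then show "(\<exists>m. minimal_relaxed_complete_partition e r m xs) \<longleftrightarrow>
      (\<exists>m. relaxed_complete_partition e r m xs) \<and>
      real (sum_list xs) \<in>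
        {(real e + 1) * (((real r + 1) ^ n - 1) / real r) + 1 ..
         (real e + 1) * (((real r + 1) ^ (n + 1) - 1) / real r)}"
    unfolding real_max_sum[OF assms]
    using sum len by (auto simp: minimal_relaxed_complete_partition_iff[OF assms])
qed

end
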